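(* Let $T$ be a tree with at least two vertices in which the distance between any two pendant vertices is even, and let $F(T)$ be its set of vertices of degree $1$. If $|F(T)|>M(T)+2$, then $\widetilde{T}\notin\mathfrak{N}$.
   Context: All graphs are finite, without loops or multiple edges. An interval $t$-coloring of a graph $G$ is a proper edge-coloring of $G$ with colors $1,\ldots,t$ such that every color is used and for every vertex $v$ the set of colors of edges incident to $v$ is an interval of integers. $\mathfrak{N}$ denotes the set of graphs having an interval $t$-coloring for some positive integer $t$. For a tree $T$ with vertices $v_1,\ldots,v_n$ ($n\geq2$) and vertices $v_i,v_j$, let $P(v_i,v_j)$ be the unique path joining them, with vertex set $VP(v_i,v_j)$ and edge set $EP(v_i,v_j)$, and define $L(v_i,v_j)=|EP(v_i,v_j)|+|\{uw\in E(T): u\in VP(v_i,v_j), w\notin VP(v_i,v_j)\}|$ and $M(T)=\max_{1\leq i,j\leq n}L(v_i,v_j)$. The graph $\widetilde{T}$ is obtained from $T$ by adding a new vertex $u$ and joining $u$ to every vertex of $F(T)$; it is a connected bipartite graph with maximum degree $|F(T)|$. *)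

theory Defs
  imports Main
begin

record 'a ugraph =
  verts :: "'a set"
  edges :: "'a set set"

definition simple_graph :: "'a ugraph \<Rightarrow> bool" where
  "simple_graph G \<longleftrightarrow> finite (verts G) \<and> (\<forall>e\<in>edges G. e \<subseteq> verts G \<and> card e = 2)"

definition incident_edges :: "'a ugraph \<Rightarrow> 'a \<Rightarrow> 'a set set" where
  "incident_edges G v = {e \<in> edges G. v \<in> e}"

definition degree :: "'a ugraph \<Rightarrow> 'a \<Rightarrow> nat" where
  "degree G v = card (incident_edges G v)"

text \<open>Paths are given by their vertex sequences; \<open>[v]\<close> is the path of length 0 from \<open>v\<close> to \<open>v\<close>.\<close>

definition path_between :: "'a ugraph \<Rightarrow> 'a \<Rightarrow> 'a list \<Rightarrow> 'a \<Rightarrow> bool" where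
  "path_between G u p v \<longleftrightarrow>
     p \<noteq> [] \<and> hd p = u \<and> last p = v \<and> set p \<subseteq> verts G \<and> distinct p \<and>
     successively (\<lambda>x y. {x, y} \<in> edges G) p"

definition cycle :: "'a ugraph \<Rightarrow> 'a list \<Rightarrow> bool" where
  "cycle G p \<longleftrightarrow>
     length p \<ge> 3 \<and> set p \<subseteq> verts G \<and> distinct p \<and>
     successively (\<lambda>x y. {x, y} \<in> edges G) p \<and> {last p, hd p} \<in> edges G"

definition connected_graph :: "'a ugraph \<Rightarrow> bool" where
  "connected_graph G \<longleftrightarrow>
     verts G \<noteq> {} \<and> (\<forall>u\<in>verts G. \<forall>v\<in>verts G. \<exists>p. path_between G u p v)"

definition tree :: "'a ugraph \<Rightarrow> bool" where
  "tree G \<longleftrightarrow> simple_graph G \<and> connected_graph G \<and> (\<nexists>p. cycle G p)"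

definition graph_dist :: "'a ugraph \<Rightarrow> 'a \<Rightarrow> 'a \<Rightarrow> nat" where
  "graph_dist G u v = (LEAST n. \<exists>p. path_between G u p v \<and> length p = Suc n)"

definition pendant_verts :: "'a ugraph \<Rightarrow> 'a set" where
  "pendant_verts G = {v \<in> verts G. degree G v = 1}"

definition tree_path :: "'a ugraph \<Rightarrow> 'a \<Rightarrow> 'a \<Rightarrow> 'a list" where
  "tree_path T u v = (THE p. path_between T u p v)"

definition VP :: "'a ugraph \<Rightarrow> 'a \<Rightarrow> 'a \<Rightarrow> 'a set" where
  "VP T u v = set (tree_path T u v)"

definition EP :: "'a ugraph \<Rightarrow> 'a \<Rightarrow> 'a \<Rightarrow> 'a set set" where
  "EP T u v = {{tree_path T u v ! i, tree_path T u v ! Suc i} | i. Suc i < length (tree_path T u v)}"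

definition L :: "'a ugraph \<Rightarrow> 'a \<Rightarrow> 'a \<Rightarrow> nat" where
  "L T x y = card (EP T x y) +
     card {{u, w} | u w. {u, w} \<in> edges T \<and> u \<in> VP T x y \<and> w \<notin> VP T x y}"

definition M :: "'a ugraph \<Rightarrow> nat" where
  "M T = Max {L T x y | x y. x \<in> verts T \<and> y \<in> verts T}"

text \<open>The new vertex is \<open>None\<close>; the copy of \<open>T\<close> lives on \<open>Some\<close>.\<close>

definition tree_tilde :: "'a ugraph \<Rightarrow> 'a option ugraph" where
  "tree_tilde T =
     \<lparr> verts = insert None (Some ` verts T),
       edges = (\<lambda>e. Some ` e) ` edges T \<union> {{None, Some v} | v. v \<in> pendant_verts T} \<rparr>"

definition proper_edge_coloring :: "'a ugraph \<Rightarrow> ('a set \<Rightarrow> nat) \<Rightarrow> bool" where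
  "proper_edge_coloring G c \<longleftrightarrow>
     (\<forall>e\<in>edges G. \<forall>f\<in>edges G. e \<noteq> f \<and> e \<inter> f \<noteq> {} \<longrightarrow> c e \<noteq> c f)"

definition interval_coloring :: "'a ugraph \<Rightarrow> nat \<Rightarrow> ('a set \<Rightarrow> nat) \<Rightarrow> bool" where
  "interval_coloring G t c \<longleftrightarrow>
     proper_edge_coloring G c \<and> c ` edges G = {1..t} \<and>
     (\<forall>v\<in>verts G. \<exists>a b. c ` incident_edges G v = {a..b})"

definition interval_colorable_graphs :: "'a ugraph set" where
  "interval_colorable_graphs =
     {G. simple_graph G \<and> (\<exists>t\<ge>1. \<exists>c. interval_coloring G t c)}"

text \<open>
  Membership in \<^const>\<open>interval_colorable_graphs\<close> requires a simple graph, so the following fact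
  shows that a non-membership statement about \<^const>\<open>tree_tilde\<close> is about colorings only.
\<close>

lemma simple_graph_tree_tilde:
  assumes "simple_graph T"
  shows "simple_graph (tree_tilde T)"
  using assms
  by (auto simp: simple_graph_def tree_tilde_def pendant_verts_def card_image)

end

theory Submission
  imports Defs
begin

text \<open>
  In an interval coloring of \<^term>\<open>tree_tilde T\<close> the colors at the new vertex fill an interval of
  length \<open>|F(T)|\<close>. Join the pendant vertices that carry its smallest and its largest color by their
  path \<open>P\<close> in \<open>T\<close>. The color intervals of consecutive vertices of \<open>P\<close> share the color of the
  connecting edge, so the colors of all edges meeting \<open>P\<close> again form an interval, and it contains
  all the colors at the new vertex. As \<open>T\<close> has no cycles, \<open>P\<close> has no chords, and no interior vertex
  of \<open>P\<close> is pendant; so at most \<open>L + 2 \<le> M(T) + 2\<close> edges meet \<open>P\<close>, whence \<open>|F(T)| \<le> M(T) + 2\<close>.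
\<close>

section \<open>Unions of overlapping integer intervals\<close>

text \<open>Induction on the list: the interval of the head meets that of its successor, hence the
  interval formed by the tail, and two integer intervals with a common point have an interval as
  their union.\<close>

lemma Union_overlapping_intervals:
  fixes I :: "'a \<Rightarrow> nat set"
  assumes "xs \<noteq> []" "successively (\<lambda>x y. I x \<inter> I y \<noteq> {}) xs"
    and "\<forall>x\<in>set xs. \<exists>a b. I x = {a..b}"
  shows "\<exists>a b. (\<Union>x\<in>set xs. I x) = {a..b}"
  using assms
proof (induction xs rule: list_nonempty_induct)
  case (cons x xs)
  then obtain a b where ab: "(\<Union>x\<in>set xs. I x) = {a..b}"
    by (auto simp: successively_Cons)
  obtain a' b' where ab': "I x = {a'..b'}"
    using cons.prems by auto
  have "I x \<inter> I (hd xs) \<noteq> {}" "hd xs \<in> set xs"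
    using cons.prems cons.hyps by (auto simp: successively_Cons)
  then have "{a'..b'} \<inter> {a..b} \<noteq> {}"
    using ab ab' by blast
  then have "{a'..b'} \<union> {a..b} = {min a a'..max b b'}"
    by auto
  then show ?case
    using ab ab' by auto
qed auto

section \<open>Paths in acyclic graphs\<close>

lemma finite_edges:
  assumes "simple_graph G"
  shows "finite (edges G)"
proof (rule finite_subset)
  show "edges G \<subseteq> Pow (verts G)" "finite (Pow (verts G))"
    using assms by (auto simp: simple_graph_def)
qed

text \<open>If both paths leave \<open>u\<close> towards the same vertex, the induction hypothesis
  applies to the rest. Otherwise, following one path until it first meets the other and returning
  along the latter closes a cycle through \<open>u\<close>.\<close>

lemma path_between_unique:
  assumes acyclic: "\<nexists>p. cycle G p"
    and "path_between G u p v" "path_between G u q v"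
  shows "p = q"
  using assms(2,3)
proof (induction p arbitrary: u q)
  case Nil
  then show ?case by (simp add: path_between_def)
next
  case (Cons a p)
  have a: "a = u" using Cons.prems by (simp add: path_between_def)
  obtain q' where q: "q = u # q'"
    using Cons.prems by (cases q) (auto simp: path_between_def)
  show ?case
  proof (cases "p = [] \<or> q' = []")
    \<comment> \<open>An empty remainder means \<open>u = v\<close>; since the vertices are
      distinct, both paths are \<open>[u]\<close>.\<close>
    case True
    then show ?thesis
      using Cons.prems a q by (auto simp: path_between_def split: if_splits)
  next
    case False
    have p_path: "path_between G (hd p) p v" and q_path: "path_between G (hd q') q' v"
      using Cons.prems False q by (auto simp: path_between_def successively_Cons)
    show ?thesis
    proof (cases "hd p = hd q'")
      case True
      then show ?thesis using Cons.IH[OF p_path] q_path a q by auto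
    next
      case ne: False
      have "\<exists>x\<in>set p. x \<in> set q'"
        using p_path q_path unfolding path_between_def by (metis last_in_set)
      \<comment> \<open>Both remainders end in \<open>v\<close>, so they meet. Taking
        \<open>z\<close> as the first vertex of \<open>p\<close> on \<open>q'\<close> keeps
        \<open>A\<close> disjoint from \<open>q'\<close>, so that no vertex of the cycle below
        repeats.\<close>
      then obtain A z B where A: "p = A @ z # B" "z \<in> set q'" "\<forall>x\<in>set A. x \<notin> set q'"
        by (elim split_list_first_propE)
      then obtain C D where C: "q' = C @ z # D"
        by (meson split_list)
      \<comment> \<open>Were both empty, \<open>z\<close> would be the head of \<open>p\<close> and
        of \<open>q'\<close>. A third vertex besides \<open>u\<close> and \<open>z\<close> is thus
        available for the cycle.\<close>
      have "A \<noteq> [] \<or> C \<noteq> []"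
        using ne A C by auto
      then have len: "length (u # A @ z # rev C) \<ge> 3"
        by (cases A; cases C) auto
      have rev: "successively (\<lambda>x y. {x, y} \<in> edges G) (z # rev C)"
      proof -
        have "successively (\<lambda>x y. {x, y} \<in> edges G) (C @ [z])"
          using Cons.prems(2) q C
          by (auto simp: path_between_def successively_append_iff successively_Cons)
        then have "successively (\<lambda>x y. {y, x} \<in> edges G) (rev (C @ [z]))"
          by (subst successively_rev) (simp add: insert_commute)
        then show ?thesis by (simp add: insert_commute)
      qed
      have "successively (\<lambda>x y. {x, y} \<in> edges G) (u # A @ [z])"
        using Cons.prems(1) A(1) a successively_append_iff[of _ "u # A @ [z]" B]
        by (simp add: path_between_def)
      with rev have "successively (\<lambda>x y. {x, y} \<in> edges G) (u # A @ z # rev C)"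
        using successively_append_iff[of "\<lambda>x y. {x, y} \<in> edges G" "u # A @ [z]" "rev C"]
        by (auto simp: successively_Cons)
      \<comment> \<open>The closing edge is the first edge of \<open>q\<close>: the last vertex of
        the list is \<open>hd q'\<close>, which is \<open>z\<close> itself when \<open>C\<close> is
        empty.\<close>
      moreover have "{last (u # A @ z # rev C), u} \<in> edges G"
        using Cons.prems(2) q C by (cases C) (auto simp: path_between_def insert_commute)
      moreover have "distinct (u # A @ z # rev C)" "set (u # A @ z # rev C) \<subseteq> verts G"
        using Cons.prems A C a q by (auto simp: path_between_def)
      ultimately have "cycle G (u # A @ z # rev C)"
        using len unfolding cycle_def by simp
      then show ?thesis using acyclic by blast
    qed
  qed
qed

lemma tree_path_between:
  assumes "tree T" "u \<in> verts T" "v \<in> verts T"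
  shows "path_between T u (tree_path T u v) v"
proof -
  obtain p where p: "path_between T u p v"
    using assms unfolding tree_def connected_graph_def by blast
  moreover have "tree_path T u v = p"
    unfolding tree_path_def
    using p path_between_unique assms(1) by (intro the_equality) (auto simp: tree_def)
  ultimately show ?thesis by simp
qed

text \<open>An edge between two non-consecutive vertices of a path closes a cycle with the segment
  between them.\<close>

lemma path_chord_consecutive:
  assumes acyclic: "\<nexists>p. cycle G p" and p: "path_between G u p v"
    and "i < j" "j < length p" "{p ! i, p ! j} \<in> edges G"
  shows "j = Suc i"
proof (rule ccontr)
  assume "j \<noteq> Suc i"
  \<comment> \<open>The segment from position \<open>i\<close> to position \<open>j\<close> has
    \<open>j - i + 1\<close> vertices, which is at least 3 once \<open>j\<close> differs from
    \<open>Suc i\<close>.\<close>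
  define q where "q = drop i (take (Suc j) p)"
  have "take i p @ q @ drop (Suc j) p = p"
    unfolding q_def using assms(3)
    by (metis append.assoc append_take_drop_id less_SucI min_absorb1 order_less_imp_le take_take)
  then have "successively (\<lambda>x y. {x, y} \<in> edges G) q"
    using p unfolding path_between_def by (metis successively_append_iff)
  moreover have "distinct q" "set q \<subseteq> verts G"
    using p unfolding path_between_def q_def by (auto dest!: in_set_dropD in_set_takeD)
  moreover have "length q \<ge> 3"
    using assms(3,4) \<open>j \<noteq> Suc i\<close> by (auto simp: q_def)
  moreover have "hd q = p ! i" "last q = p ! j"
    using assms(3,4) by (auto simp: q_def hd_drop_conv_nth last_conv_nth)
  ultimately have "cycle G q"
    using assms(5) by (simp add: cycle_def insert_commute)
  then show False using acyclic by blast
qed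

text \<open>The edges to the predecessor and to the successor both contain an interior vertex; if it
  had degree 1, they would coincide and the path would repeat a vertex.\<close>

lemma interior_not_pendant:
  assumes "simple_graph G" "path_between G u p v" "x \<in> set p" "x \<in> pendant_verts G"
  shows "x = u \<or> x = v"
proof (rule ccontr)
  assume ne: "\<not> (x = u \<or> x = v)"
  obtain A B where AB: "p = A @ x # B"
    using assms(3) by (meson split_list)
  have nonempty: "A \<noteq> []" "B \<noteq> []"
    using ne AB assms(2) by (auto simp: path_between_def)
  then have "{last A, x} \<in> incident_edges G x" "{x, hd B} \<in> incident_edges G x"
    using assms(2) AB
    by (auto simp: path_between_def incident_edges_def successively_append_iff successively_Cons)
  moreover obtain e where "incident_edges G x = {e}"
    using assms(4) by (auto simp: pendant_verts_def degree_def card_1_singleton_iff)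
  ultimately have "last A = hd B"
    by (auto simp: doubleton_eq_iff)
  moreover have "last A \<in> set A" "hd B \<in> set B"
    using nonempty by auto
  ultimately show False
    using assms(2) AB by (auto simp: path_between_def)
qed

section \<open>Counting the edges that meet a path\<close>

text \<open>The two summands of \<open>L\<close> count disjoint sets: path edges have both ends on
  the path, the others exactly one. They exhaust the edges meeting the path because an edge with
  both ends on it is no chord.\<close>

lemma L_eq_card_edges_meeting_path:
  assumes "tree T" "x \<in> verts T" "y \<in> verts T"
  shows "L T x y = card {e \<in> edges T. e \<inter> VP T x y \<noteq> {}}"
proof -
  let ?p = "tree_path T x y"
  let ?off = "{{u, w} | u w. {u, w} \<in> edges T \<and> u \<in> VP T x y \<and> w \<notin> VP T x y}"
  have p: "path_between T x ?p y"
    using tree_path_between[OF assms] .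
  have simple: "simple_graph T" and acyclic: "\<nexists>p. cycle T p"
    using assms(1) by (auto simp: tree_def)
  have fin: "finite (edges T)"
    using finite_edges[OF simple] .
  have EP_edges: "EP T x y \<subseteq> edges T"
    using p by (auto simp: EP_def path_between_def successively_conv_nth)
  have off_edges: "?off \<subseteq> edges T" by auto
  have EP_inside: "e \<subseteq> VP T x y" if "e \<in> EP T x y" for e
    using that by (auto simp: EP_def VP_def)
  have "EP T x y \<inter> ?off = {}"
    using EP_inside by blast
  moreover have "EP T x y \<union> ?off = {e \<in> edges T. e \<inter> VP T x y \<noteq> {}}"
  proof (intro equalityI subsetI)
    fix e assume "e \<in> EP T x y \<union> ?off"
    moreover have "e \<inter> VP T x y \<noteq> {}" if "e \<in> EP T x y"
      using that by (auto simp: EP_def VP_def)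
    ultimately show "e \<in> {e \<in> edges T. e \<inter> VP T x y \<noteq> {}}"
      using EP_edges by auto
  next
    fix e assume "e \<in> {e \<in> edges T. e \<inter> VP T x y \<noteq> {}}"
    then obtain u where e: "e \<in> edges T" "u \<in> e" "u \<in> VP T x y" by auto
    then have "card e = 2"
      using simple by (simp add: simple_graph_def)
    then obtain w where w: "e = {u, w}" "u \<noteq> w"
      using e(2) by (auto simp: card_2_iff)
    show "e \<in> EP T x y \<union> ?off"
    proof (cases "w \<in> VP T x y")
      case False
      then show ?thesis using e w by auto
    next
      case True
      then obtain i j where ij: "i < length ?p" "j < length ?p" "u = ?p ! i" "w = ?p ! j"
        using e by (auto simp: VP_def in_set_conv_nth)
      then have "i \<noteq> j" using w by auto
      then have "j = Suc i \<or> i = Suc j"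
        using path_chord_consecutive[OF acyclic p, of i j] path_chord_consecutive[OF acyclic p, of j i]
          ij e w by (auto simp: insert_commute not_less_iff_gr_or_eq nat_neq_iff)
      then have "e \<in> EP T x y"
        unfolding EP_def using ij w by (auto simp: insert_commute)
      then show ?thesis by simp
    qed
  qed
  ultimately show ?thesis
    unfolding L_def using fin EP_edges off_edges
    by (metis (no_types, lifting) card_Un_disjoint finite_subset)
qed

lemma L_le_M:
  assumes "finite (verts T)" "x \<in> verts T" "y \<in> verts T"
  shows "L T x y \<le> M T"
proof -
  have "{L T x y | x y. x \<in> verts T \<and> y \<in> verts T} = (\<lambda>(x, y). L T x y) ` (verts T \<times> verts T)"
    by auto
  then have "finite {L T x y | x y. x \<in> verts T \<and> y \<in> verts T}"
    using assms(1) by simp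
  then show ?thesis
    unfolding M_def using assms(2,3) by (intro Max_ge) auto
qed

section \<open>Colors at the new vertex and along the path\<close>

lemma incident_edges_tree_tilde_None:
  "incident_edges (tree_tilde T) None = (\<lambda>v. {None, Some v}) ` pendant_verts T"
  by (auto simp: incident_edges_def tree_tilde_def)

lemma card_pendant_le_if_interval_coloring:
  assumes T: "tree T" and col: "interval_coloring (tree_tilde T) t c"
  shows "card (pendant_verts T) \<le> M T + 2"
proof (cases "pendant_verts T = {}")
  case False
  let ?G = "tree_tilde T"
  let ?I = "\<lambda>x. c ` incident_edges ?G (Some x)"
  have simple: "simple_graph T" using T by (simp add: tree_def)
  have fin: "finite (edges T)"
    using finite_edges[OF simple] .
  have proper: "proper_edge_coloring ?G c"
    and interval: "\<And>v. v \<in> verts ?G \<Longrightarrow> \<exists>a b. c ` incident_edges ?G v = {a..b}"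
    using col by (auto simp: interval_coloring_def)
  obtain a b where ab: "c ` incident_edges ?G None = {a..b}"
    using interval[of None] by (auto simp: tree_tilde_def)
  \<comment> \<open>All edges at the new vertex share it, so a proper coloring gives them distinct
    colors, one for each pendant vertex.\<close>
  have "inj_on c (incident_edges ?G None)"
    using proper unfolding proper_edge_coloring_def inj_on_def incident_edges_def by blast
  moreover have "inj_on (\<lambda>v. {None, Some v}) (pendant_verts T)"
    by (auto simp: inj_on_def doubleton_eq_iff)
  ultimately have card_F: "card (pendant_verts T) = card {a..b}"
    by (metis ab card_image incident_edges_tree_tilde_None)
  \<comment> \<open>Only for a nonempty interval are the bounds \<open>a\<close> and
    \<open>b\<close> themselves colors at the new vertex.\<close>
  have "{a..b} \<noteq> {}"
    using False ab by (metis image_is_empty incident_edges_tree_tilde_None)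
  then have "a \<in> c ` incident_edges ?G None" "b \<in> c ` incident_edges ?G None"
    using ab by auto
  then obtain x y where x: "x \<in> pendant_verts T" "c {None, Some x} = a"
    and y: "y \<in> pendant_verts T" "c {None, Some y} = b"
    unfolding incident_edges_tree_tilde_None by auto
  have xy: "x \<in> verts T" "y \<in> verts T"
    using x y by (auto simp: pendant_verts_def)
  let ?p = "tree_path T x y"
  have p: "path_between T x ?p y"
    using tree_path_between[OF T xy] .
  let ?S = "\<Union>z\<in>set ?p. incident_edges ?G (Some z)"
  have "successively (\<lambda>u w. {u, w} \<in> edges T) ?p"
    using p by (simp add: path_between_def)
  then have "successively (\<lambda>u w. ?I u \<inter> ?I w \<noteq> {}) ?p"
  proof (rule successively_mono)
    fix u w assume "{u, w} \<in> edges T"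
    then have "Some ` {u, w} \<in> edges ?G"
      unfolding tree_tilde_def by (metis (no_types, lifting) UnI1 image_eqI ugraph.select_convs(2))
    then have "{Some u, Some w} \<in> incident_edges ?G (Some u) \<inter> incident_edges ?G (Some w)"
      by (simp add: incident_edges_def)
    then show "?I u \<inter> ?I w \<noteq> {}" by blast
  qed
  moreover have "\<forall>z\<in>set ?p. \<exists>a b. ?I z = {a..b}"
  proof
    fix z assume "z \<in> set ?p"
    then have "Some z \<in> verts ?G"
      using p by (auto simp: path_between_def tree_tilde_def)
    then show "\<exists>a b. ?I z = {a..b}" by (rule interval)
  qed
  moreover have "?p \<noteq> []"
    using p by (simp add: path_between_def)
  ultimately obtain a' b' where "(\<Union>z\<in>set ?p. ?I z) = {a'..b'}"
    using Union_overlapping_intervals[of ?p ?I] by auto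
  then have S: "c ` ?S = {a'..b'}" by (simp add: image_UN)
  have "x \<in> set ?p" "y \<in> set ?p"
    using p unfolding path_between_def by (metis hd_in_set, metis last_in_set)
  moreover have "{None, Some x} \<in> incident_edges ?G (Some x)"
      "{None, Some y} \<in> incident_edges ?G (Some y)"
    using x y by (auto simp: incident_edges_def tree_tilde_def)
  ultimately have "a \<in> c ` ?S" "b \<in> c ` ?S"
    using x(2) y(2) by blast+
  then have ab_S: "{a..b} \<subseteq> c ` ?S"
    using S by auto
  let ?E = "{e \<in> edges T. e \<inter> VP T x y \<noteq> {}}"
  \<comment> \<open>An edge of \<open>?G\<close> meeting the path is a copy of a tree edge or joins
    the new vertex to a pendant vertex of the path, which can only be an end \<open>x\<close> or
    \<open>y\<close>.\<close>
  have S_sub: "?S \<subseteq> image Some ` ?E \<union> {{None, Some x}, {None, Some y}}"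
  proof
    fix e assume "e \<in> ?S"
    then obtain z where z: "z \<in> set ?p" "e \<in> edges ?G" "Some z \<in> e"
      by (auto simp: incident_edges_def)
    then consider f where "f \<in> edges T" "e = Some ` f"
      | w where "w \<in> pendant_verts T" "e = {None, Some w}"
      by (auto simp: tree_tilde_def)
    then show "e \<in> image Some ` ?E \<union> {{None, Some x}, {None, Some y}}"
    proof cases
      case 1
      then show ?thesis using z by (auto simp: VP_def)
    next
      case 2
      then have "z = x \<or> z = y"
        using z interior_not_pendant[OF simple p] by auto
      then show ?thesis using 2 z by auto
    qed
  qed
  have finE: "finite ?E" using fin by simp
  have fin_sup: "finite (image Some ` ?E \<union> {{None, Some x}, {None, Some y}})"
    using finE by simp
  have "card (pendant_verts T) \<le> card (c ` ?S)"
    unfolding card_F using ab_S S by (intro card_mono) auto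
  also have "\<dots> \<le> card ?S"
    using finite_subset[OF S_sub fin_sup] by (rule card_image_le)
  also have "\<dots> \<le> card (image Some ` ?E \<union> {{None, Some x}, {None, Some y}})"
    using fin_sup S_sub by (rule card_mono)
  also have "\<dots> \<le> card (image Some ` ?E) + card {{None, Some x}, {None, Some y}}"
    by (rule card_Un_le)
  \<comment> \<open>The summand 2 bounds the number of new edges at the ends \<open>x\<close> and
    \<open>y\<close>, whether or not these coincide.\<close>
  also have "\<dots> \<le> card ?E + 2"
    using card_image_le[OF finE, of "image Some"] by (intro add_mono) (auto simp: card_insert_if)
  also have "\<dots> = L T x y + 2"
    using L_eq_card_edges_meeting_path[OF T xy] by simp
  also have "\<dots> \<le> M T + 2"
    using L_le_M[OF _ xy] simple by (simp add: simple_graph_def)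
  finally show ?thesis .
qed simp

theorem theorem9:
  fixes T :: "'a ugraph"
  assumes "tree T"
    and "card (verts T) \<ge> 2"
    and "\<forall>u\<in>pendant_verts T. \<forall>v\<in>pendant_verts T. even (graph_dist T u v)"
    and "card (pendant_verts T) > M T + 2"
  shows "tree_tilde T \<notin> interval_colorable_graphs"
  using card_pendant_le_if_interval_coloring[OF assms(1)] assms(4)
  by (force simp: interval_colorable_graphs_def)

end
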